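(* Let $(S_1,\dots,S_k)\in P_m$ be a partition of $N$ with set sizes given by $m$, and let $X\in\mathbb{R}^{n\times k}$ be the associated partition matrix. Then $$|\delta(S)|=\tfrac12\operatorname{trace}\bigl((A-\operatorname{Diag}(d))\,X B X^T\bigr)\qquad\text{for all } d\in\mathbb{R}^n .$$ In particular, the choices $d=0$ and $d=Ae$ yield this formula with $A-\operatorname{Diag}(d)$ equal to $A$ and to $-L$, respectively.
   Context: Setting: an undirected (simple) graph with node set $N=\{1,\dots,n\}$ and nonempty edge set, adjacency matrix $A$, and Laplacian $L=\operatorname{Diag}(Ae)-A$; $e$ is the all-ones vector of appropriate size and $\operatorname{Diag}(v)$ is the diagonal matrix with diagonal $v$. $k>2$ is an integer and $m=(m_1,\dots,m_k)^T$ is a vector of positive integers with $m_1+\dots+m_k=n$. $P_m$ is the set of ordered partitions $(S_1,\dots,S_k)$ of $N$ with $|S_i|=m_i$ for all $i$. The partition matrix $X$ of $(S_1,\dots,S_k)$ has $X_{ij}=1$ if $i\in S_j$ and $X_{ij}=0$ otherwise. $\delta(S_i,S_j)$ is the set of edges with one endpoint in $S_i$ and the other in $S_j$, and $\delta(S)=\bigcup_{i<j<k}\delta(S_i,S_j)$ is the set of edges joining distinct sets among $S_1,\dots,S_{k-1}$ (the $k$-th set is excluded). $B$ is the symmetric $k\times k$ matrix $$B=\begin{bmatrix} ee^T-I_{k-1} & 0\\ 0&0\end{bmatrix}.$$ *)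

theory Defs
  imports "Jordan_Normal_Form.Matrix"
begin

text \<open>
  Indices start at 0, as in the matrix library: the node set is \<open>{..<n}\<close>, and the sets
  \<open>S\<^sub>1, \<dots>, S\<^sub>k\<close> and the sizes \<open>m\<^sub>1, \<dots>, m\<^sub>k\<close> are the list entries
  \<open>S ! 0, \<dots>, S ! (k - 1)\<close> and \<open>m ! 0, \<dots>, m ! (k - 1)\<close>.
\<close>

definition simple_graph :: "nat \<Rightarrow> nat set set \<Rightarrow> bool" where
  "simple_graph n E \<longleftrightarrow> E \<subseteq> {{u, v} | u v. u < n \<and> v < n \<and> u \<noteq> v}"

definition ones_vec :: "nat \<Rightarrow> real vec" where
  "ones_vec n = vec n (\<lambda>_. 1)"

definition Diag :: "real vec \<Rightarrow> real mat" where
  "Diag v = mat_diag (dim_vec v) (\<lambda>i. v $ i)"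

definition trace_mat :: "real mat \<Rightarrow> real" where
  "trace_mat M = (\<Sum>i<dim_row M. M $$ (i, i))"

definition adjacency_mat :: "nat \<Rightarrow> nat set set \<Rightarrow> real mat" where
  "adjacency_mat n E = mat n n (\<lambda>(i, j). if {i, j} \<in> E then 1 else 0)"

definition laplacian_mat :: "nat \<Rightarrow> nat set set \<Rightarrow> real mat" where
  "laplacian_mat n E = Diag (adjacency_mat n E *\<^sub>v ones_vec n) - adjacency_mat n E"

definition ordered_partitions :: "nat \<Rightarrow> nat list \<Rightarrow> nat set list set" where
  "ordered_partitions n m =
    {S. length S = length m \<and>
        (\<Union>j<length S. S ! j) = {..<n} \<and>
        (\<forall>i<length S. \<forall>j<length S. i \<noteq> j \<longrightarrow> S ! i \<inter> S ! j = {}) \<and>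
        (\<forall>j<length S. card (S ! j) = m ! j)}"

definition partition_mat :: "nat \<Rightarrow> nat set list \<Rightarrow> real mat" where
  "partition_mat n S = mat n (length S) (\<lambda>(i, j). if i \<in> S ! j then 1 else 0)"

definition edges_between :: "nat set set \<Rightarrow> nat set \<Rightarrow> nat set \<Rightarrow> nat set set" where
  "edges_between E S T = {e \<in> E. \<exists>u\<in>S. \<exists>v\<in>T. e = {u, v}}"

text \<open>The last set of the list is left out: only pairs \<open>i < j < k - 1\<close> of 0-based indices count.\<close>

definition cut_edges :: "nat set set \<Rightarrow> nat set list \<Rightarrow> nat set set" where
  "cut_edges E S =
    \<Union>{edges_between E (S ! i) (S ! j) | i j. i < j \<and> j < length S - 1}"

definition ones_outer :: "nat \<Rightarrow> real mat" where
  "ones_outer n = mat_of_cols n [ones_vec n] * mat_of_rows n [ones_vec n]"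

definition B_mat :: "nat \<Rightarrow> real mat" where
  "B_mat k = four_block_mat
     (ones_outer (k - 1) - 1\<^sub>m (k - 1)) (0\<^sub>m (k - 1) 1)
     (0\<^sub>m 1 (k - 1))                     (0\<^sub>m 1 1)"

end

theory Submission
  imports Defs
begin

text \<open>
  Write \<open>p u\<close> for the index of the part that contains the node \<open>u\<close>.  Row \<open>u\<close> of the partition
  matrix \<open>X\<close> is the unit vector at position \<open>p u\<close>, so \<open>X B X\<^sup>T\<close> has the entry
  \<open>B (p u, p v)\<close> at \<open>(u, v)\<close>: it is \<open>1\<close> when \<open>u\<close> and \<open>v\<close> lie in two different parts, neither of
  which is the last one, and \<open>0\<close> otherwise (lemmas \<open>congruence_partition_mat_index\<close> and
  \<open>B_mat_index\<close>).

  Two consequences give the formula.  The diagonal of \<open>X B X\<^sup>T\<close> vanishes because that of \<open>B\<close>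
  does, so \<open>Diag d\<close> contributes nothing to the trace (lemma \<open>trace_mat_minus_Diag_mult\<close>); in
  particular \<open>- L\<close>, which differs from \<open>A\<close> only on the diagonal, gives the same trace as
  \<open>A\<close>.  And \<open>trace (A X B X\<^sup>T)\<close> counts the ordered pairs \<open>(u, v)\<close> that are joined by an edge of the cut, so each cut edge is counted once in either
  direction, which explains the factor \<open>1 / 2\<close>.  Orienting every cut edge from the part
  of smaller index to the part of larger index makes this double counting precise (lemmas
  \<open>card_cut_edges\<close> and \<open>trace_adjacency_mat_cut\<close>).
\<close>

lemma trace_mat_mult:
  assumes "M \<in> carrier_mat n n" and "W \<in> carrier_mat n n"
  shows "trace_mat (M * W) = (\<Sum>u<n. \<Sum>v<n. M $$ (u, v) * W $$ (v, u))"
  using assms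
  by (auto simp: trace_mat_def scalar_prod_def atLeast0LessThan intro!: sum.cong)

lemma Diag_carrier: "d \<in> carrier_vec n \<Longrightarrow> Diag d \<in> carrier_mat n n"
  by (auto simp: Diag_def)

lemma trace_mat_minus_Diag_mult:
  assumes A: "A \<in> carrier_mat n n" and W: "W \<in> carrier_mat n n" and d: "d \<in> carrier_vec n"
    and zero_diag: "\<And>u. u < n \<Longrightarrow> W $$ (u, u) = 0"
  shows "trace_mat ((A - Diag d) * W) = trace_mat (A * W)"
proof -
  have Diag: "Diag d \<in> carrier_mat n n"
    using d by (rule Diag_carrier)
  have "(A - Diag d) $$ (u, v) * W $$ (v, u) = A $$ (u, v) * W $$ (v, u)"
    if "u < n" "v < n" for u v
    using that A Diag d zero_diag[of u] by (cases "u = v") (auto simp: Diag_def mat_diag_def)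
  then have "(\<Sum>u<n. \<Sum>v<n. (A - Diag d) $$ (u, v) * W $$ (v, u)) =
      (\<Sum>u<n. \<Sum>v<n. A $$ (u, v) * W $$ (v, u))"
    by (intro sum.cong refl) (simp only: lessThan_iff)
  then show ?thesis
    by (simp only: trace_mat_mult[OF minus_carrier_mat[OF Diag] W] trace_mat_mult[OF A W])
qed

lemma ordered_partitions_part:
  assumes "S \<in> ordered_partitions n m"
  obtains p where "\<And>u. u < n \<Longrightarrow> p u < length m"
    and "\<And>u j. u < n \<Longrightarrow> j < length m \<Longrightarrow> u \<in> S ! j \<longleftrightarrow> j = p u"
proof -
  note parts = assms[unfolded ordered_partitions_def mem_Collect_eq]
  have len: "length S = length m"
    by (rule parts[THEN conjunct1])
  have cover: "(\<Union>j<length S. S ! j) = {..<n}"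
    by (rule parts[THEN conjunct2, THEN conjunct1])
  have disjoint: "\<forall>i<length S. \<forall>j<length S. i \<noteq> j \<longrightarrow> S ! i \<inter> S ! j = {}"
    by (rule parts[THEN conjunct2, THEN conjunct2, THEN conjunct1])
  have "\<exists>i. i < length m \<and> (\<forall>j<length m. u \<in> S ! j \<longleftrightarrow> j = i)" if "u < n" for u
  proof -
    have "u \<in> (\<Union>j<length S. S ! j)"
      unfolding cover using that by simp
    then obtain i where i: "i < length S" "u \<in> S ! i"
      by (elim UN_E) simp
    then have "u \<in> S ! j \<longleftrightarrow> j = i" if "j < length S" for j
      using disjoint that i by blast
    with i len show ?thesis
      by auto
  qed
  then obtain p where "\<forall>u<n. p u < length m \<and> (\<forall>j<length m. u \<in> S ! j \<longleftrightarrow> j = p u)"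
    by metis
  then show ?thesis
    using that[of p] by blast
qed

text \<open>Since row \<open>u\<close> of the partition matrix is a unit vector, both products merely select entries.\<close>

lemma congruence_partition_mat_index:
  assumes B: "B \<in> carrier_mat (length S) (length S)"
    and p_less: "\<And>u. u < n \<Longrightarrow> p u < length S"
    and part: "\<And>u j. u < n \<Longrightarrow> j < length S \<Longrightarrow> u \<in> S ! j \<longleftrightarrow> j = p u"
    and u: "u < n" and v: "v < n"
  shows "(partition_mat n S * B * transpose_mat (partition_mat n S)) $$ (u, v) = B $$ (p u, p v)"
proof -
  let ?X = "partition_mat n S"
  have X: "?X $$ (w, j) = (if j = p w then 1 else 0)" if "w < n" "j < length S" for w j
    using that part by (simp add: partition_mat_def)
  have X_carrier: "?X \<in> carrier_mat n (length S)"
    by (simp add: partition_mat_def)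
  have XB: "(?X * B) $$ (u, l) = B $$ (p u, l)" if "l < length S" for l
  proof -
    have "(?X * B) $$ (u, l) = (\<Sum>j<length S. ?X $$ (u, j) * B $$ (j, l))"
      using B X_carrier u that by (auto simp: scalar_prod_def atLeast0LessThan)
    also have "\<dots> = (\<Sum>j<length S. if j = p u then B $$ (j, l) else 0)"
      using u by (intro sum.cong) (auto simp: X)
    also have "\<dots> = B $$ (p u, l)"
      using p_less[OF u] by simp
    finally show ?thesis .
  qed
  have "(?X * B * transpose_mat ?X) $$ (u, v) = (\<Sum>l<length S. (?X * B) $$ (u, l) * ?X $$ (v, l))"
    using B X_carrier u v
    by (subst index_mult_mat(1)) (auto simp: scalar_prod_def atLeast0LessThan intro!: sum.cong)
  also have "\<dots> = (\<Sum>l<length S. if l = p v then B $$ (p u, l) else 0)"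
    using v by (intro sum.cong) (auto simp: X XB)
  also have "\<dots> = B $$ (p u, p v)"
    using p_less[OF v] by simp
  finally show ?thesis .
qed

lemma B_mat_carrier: "k > 0 \<Longrightarrow> B_mat k \<in> carrier_mat k k"
  by (auto simp: B_mat_def ones_outer_def)

lemma B_mat_index:
  assumes "a < k" and "b < k"
  shows "B_mat k $$ (a, b) = (if a \<noteq> b \<and> a < k - 1 \<and> b < k - 1 then 1 else 0)"
proof -
  have outer: "ones_outer r $$ (i, j) = 1" if "i < r" "j < r" for r i j
    using that
    by (simp add: ones_outer_def ones_vec_def scalar_prod_def mat_of_cols_def mat_of_rows_def)
  have dim: "dim_row (ones_outer r) = r" "dim_col (ones_outer r) = r" for r
    by (simp_all add: ones_outer_def)
  show ?thesis
    using assms by (auto simp: B_mat_def outer dim)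
qed

text \<open>
  A cut edge meets two parts with different indices, so exactly one of its two orientations
  increases the index; the pairs counted here are these orientations.
\<close>

lemma card_cut_edges:
  assumes graph: "simple_graph n E"
    and p_less: "\<And>u. u < n \<Longrightarrow> p u < length S"
    and part: "\<And>u j. u < n \<Longrightarrow> j < length S \<Longrightarrow> u \<in> S ! j \<longleftrightarrow> j = p u"
  shows "card (cut_edges E S)
    = card {(u, v). u < n \<and> v < n \<and> {u, v} \<in> E \<and> p u < p v \<and> p v < length S - 1}"
    (is "_ = card ?P")
proof -
  have less: "u < n" "v < n" if "{u, v} \<in> E" for u v
    using graph that by (auto simp: simple_graph_def doubleton_eq_iff)
  have "inj_on (\<lambda>(u, v). {u, v}) ?P"
    by (auto simp: inj_on_def doubleton_eq_iff)
  moreover have "cut_edges E S = (\<lambda>(u, v). {u, v}) ` ?P"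
  proof
    show "cut_edges E S \<subseteq> (\<lambda>(u, v). {u, v}) ` ?P"
    proof
      fix e assume "e \<in> cut_edges E S"
      then obtain i j u v where *: "i < j" "j < length S - 1" "{u, v} \<in> E" "e = {u, v}"
          "u \<in> S ! i" "v \<in> S ! j"
        by (auto simp: cut_edges_def edges_between_def)
      moreover have "i = p u" "j = p v"
        using * less[of u v] part by auto
      ultimately have "(u, v) \<in> ?P"
        using less by auto
      with \<open>e = {u, v}\<close> show "e \<in> (\<lambda>(u, v). {u, v}) ` ?P"
        by (intro image_eqI[of _ _ "(u, v)"]) auto
    qed
    show "(\<lambda>(u, v). {u, v}) ` ?P \<subseteq> cut_edges E S"
    proof
      fix e assume "e \<in> (\<lambda>(u, v). {u, v}) ` ?P"
      then obtain u v where *: "e = {u, v}" "u < n" "v < n" "{u, v} \<in> E" "p u < p v"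
          "p v < length S - 1"
        by auto
      then have "u \<in> S ! p u" "v \<in> S ! p v"
        using part p_less by auto
      with * have "e \<in> edges_between E (S ! p u) (S ! p v)"
        by (auto simp: edges_between_def)
      with * show "e \<in> cut_edges E S"
        unfolding cut_edges_def by blast
    qed
  qed
  ultimately show ?thesis
    by (simp add: card_image)
qed

text \<open>
  The factor \<open>2\<close>: the trace runs over both orientations of each cut
  edge, and reversal matches the two kinds.
\<close>

lemma trace_adjacency_mat_cut:
  assumes graph: "simple_graph n E"
    and p_less: "\<And>u. u < n \<Longrightarrow> p u < length S"
    and part: "\<And>u j. u < n \<Longrightarrow> j < length S \<Longrightarrow> u \<in> S ! j \<longleftrightarrow> j = p u"
    and W: "W \<in> carrier_mat n n"
    and W_index: "\<And>u v. u < n \<Longrightarrow> v < n \<Longrightarrow> W $$ (u, v) =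
      (if p u \<noteq> p v \<and> p u < length S - 1 \<and> p v < length S - 1 then 1 else 0)"
  shows "trace_mat (adjacency_mat n E * W) = 2 * real (card (cut_edges E S))"
proof -
  define P where "P = {(u, v). u < n \<and> v < n \<and> {u, v} \<in> E \<and> p u < p v \<and> p v < length S - 1}"
  define f :: "nat \<Rightarrow> nat \<Rightarrow> real" where "f u v = (if (u, v) \<in> P then 1 else 0)" for u v
  have P_sub: "P \<subseteq> {..<n} \<times> {..<n}"
    by (auto simp: P_def)
  have "(\<Sum>u<n. \<Sum>v<n. f u v) = (\<Sum>x\<in>{..<n} \<times> {..<n}. if x \<in> P then 1 else 0)"
    by (simp add: sum.cartesian_product f_def case_prod_unfold)
  also have "\<dots> = real (card P)"
    using P_sub by (simp flip: sum.inter_restrict add: Int_absorb1)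
  finally have count: "(\<Sum>u<n. \<Sum>v<n. f u v) = real (card P)" .
  have entry: "adjacency_mat n E $$ (u, v) * W $$ (v, u) = f u v + f v u" if "u < n" "v < n" for u v
    using that by (auto simp: adjacency_mat_def W_index f_def P_def insert_commute)
  have "trace_mat (adjacency_mat n E * W) =
      (\<Sum>u<n. \<Sum>v<n. adjacency_mat n E $$ (u, v) * W $$ (v, u))"
    using W by (intro trace_mat_mult) (simp_all add: adjacency_mat_def)
  also have "\<dots> = (\<Sum>u<n. \<Sum>v<n. f u v) + (\<Sum>u<n. \<Sum>v<n. f v u)"
    by (simp add: entry sum.distrib)
  also have "(\<Sum>u<n. \<Sum>v<n. f v u) = (\<Sum>u<n. \<Sum>v<n. f u v)"
    by (rule sum.swap)
  finally show ?thesis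
    using card_cut_edges[OF graph p_less part] by (simp add: count P_def)
qed

theorem proposition2p3:
  fixes n k :: nat and E :: "nat set set" and m :: "nat list" and S :: "nat set list"
    and A L X B :: "real mat"
  assumes graph: "simple_graph n E"
    and nonempty: "E \<noteq> {}"
    and k: "k > 2"
    and length_m: "length m = k"
    and pos_m: "\<forall>j<k. m ! j > 0"
    and sum_m: "(\<Sum>j<k. m ! j) = n"
    and S: "S \<in> ordered_partitions n m"
  defines "A \<equiv> adjacency_mat n E"
    and "L \<equiv> laplacian_mat n E"
    and "X \<equiv> partition_mat n S"
    and "B \<equiv> B_mat k"
  shows "(\<forall>d \<in> carrier_vec n.
            real (card (cut_edges E S)) =
              1 / 2 * trace_mat ((A - Diag d) * (X * B * transpose_mat X))) \<and>
         A - Diag (0\<^sub>v n) = A \<and>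
         A - Diag (A *\<^sub>v ones_vec n) = - L \<and>
         real (card (cut_edges E S)) = 1 / 2 * trace_mat (A * (X * B * transpose_mat X)) \<and>
         real (card (cut_edges E S)) = 1 / 2 * trace_mat (- L * (X * B * transpose_mat X))"
proof -
  have len: "length S = k"
    using S length_m by (simp add: ordered_partitions_def)
  obtain p where p_less: "\<And>u. u < n \<Longrightarrow> p u < length S"
    and part: "\<And>u j. u < n \<Longrightarrow> j < length S \<Longrightarrow> u \<in> S ! j \<longleftrightarrow> j = p u"
    using ordered_partitions_part[OF S] len length_m by metis
  define W where "W = X * B * transpose_mat X"
  have A: "A \<in> carrier_mat n n"
    by (simp add: A_def adjacency_mat_def)
  have B: "B \<in> carrier_mat (length S) (length S)"
    using k by (simp add: B_def len B_mat_carrier)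
  have W: "W \<in> carrier_mat n n"
    by (auto simp: W_def X_def partition_mat_def)
  have W_index: "W $$ (u, v) =
      (if p u \<noteq> p v \<and> p u < length S - 1 \<and> p v < length S - 1 then 1 else 0)"
    if "u < n" "v < n" for u v
  proof -
    have "W $$ (u, v) = B $$ (p u, p v)"
      unfolding W_def X_def by (rule congruence_partition_mat_index[OF B p_less part that])
    then show ?thesis
      using p_less that by (simp add: B_def B_mat_index len)
  qed
  have cut: "real (card (cut_edges E S)) = 1 / 2 * trace_mat (A * W)"
    using trace_adjacency_mat_cut[OF graph p_less part W W_index] by (simp add: A_def)
  have cut_d: "real (card (cut_edges E S)) = 1 / 2 * trace_mat ((A - Diag d) * W)"
    if "d \<in> carrier_vec n" for d
    using cut trace_mat_minus_Diag_mult[OF A W that] W_index by simp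
  have zero: "A - Diag (0\<^sub>v n) = A"
    using A by (intro eq_matI) (auto simp: Diag_def mat_diag_def)
  have degrees: "A *\<^sub>v ones_vec n \<in> carrier_vec n"
    by (rule mult_mat_vec_carrier[OF A]) (simp add: ones_vec_def)
  have minus_L: "A - Diag (A *\<^sub>v ones_vec n) = - L"
  proof -
    have "A - D = - (D - A)" if "D \<in> carrier_mat n n" for D
      using A that by (intro eq_matI) auto
    from this[OF Diag_carrier[OF degrees]] show ?thesis
      by (simp only: L_def laplacian_mat_def A_def)
  qed
  from cut_d[OF degrees] have cut_L: "real (card (cut_edges E S)) = 1 / 2 * trace_mat (- L * W)"
    unfolding minus_L .
  show ?thesis
    unfolding W_def[symmetric]
    by (intro conjI ballI) (fact cut_d zero minus_L cut cut_L)+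
qed

end
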